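(* Let $\mathbb{F}$ be a field, let $k$ be a positive integer, and let $\Delta$ be a $(k+1)$-neighbourly $k$-stacked $\mathbb{F}$-homology manifold with boundary. Then $\Delta$ is $\mathbb{F}$-tight.
   Context: Simplicial complexes are finite and abstract, and contain the empty face. $V(X)$ is the vertex set of $X$. For $A\subseteq V(X)$, $X[A]=\{\alpha\in X:\alpha\subseteq A\}$ is the induced subcomplex on $A$. For a complex $X$ and $0\le j\le \dim X$, $\mathrm{Skel}_j(X)=\{\alpha\in X:\dim\alpha\le j\}$. Homology manifolds (standard definitions): the link of a face $\alpha$ of $X$ is $\{\gamma\in X:\gamma\cap\alpha=\emptyset,\ \gamma\cup\alpha\in X\}$. An $\mathbb{F}$-homology $n$-manifold without boundary is a pure $n$-dimensional complex in which the link of every nonempty face $\alpha$ has the reduced $\mathbb{F}$-homology of a sphere of dimension $n-\#\alpha$. An $\mathbb{F}$-homology $n$-manifold with boundary is a pure $n$-dimensional complex $\Delta$ in which the link of every nonempty face $\alpha$ has either the reduced $\mathbb{F}$-homology of a sphere of dimension $n-\#\alpha$ or trivial reduced $\mathbb{F}$-homology, and such that the boundary $\partial\Delta$, consisting of the empty face and the nonempty faces whose link has trivial reduced homology, is a (nonempty) $\mathbb{F}$-homology $(n-1)$-manifold without boundary. $k$-stacked: an $\mathbb{F}$-homology manifold $\Delta$ with boundary of dimension $d+1$ is $k$-stacked (where $1\le k\le d$) if $\mathrm{Skel}_{d-k}(\Delta)=\mathrm{Skel}_{d-k}(\partial\Delta)$. $(k+1)$-neighbourly: any $k+1$ vertices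 of $X$ form a face of $X$. $\mathbb{F}$-tight: $X$ is connected and, for every induced subcomplex $Y$ of $X$, the $\mathbb{F}$-linear map $H_*(Y;\mathbb{F})\to H_*(X;\mathbb{F})$ induced by inclusion is injective in all degrees. *)

theory Defs
  imports Main
begin

section \<open>Finite abstract simplicial complexes\<close>

definition simplicial_complex :: "'a set set \<Rightarrow> bool" where
  "simplicial_complex X \<longleftrightarrow>
     finite X \<and> {} \<in> X \<and> (\<forall>\<alpha>\<in>X. finite \<alpha> \<and> (\<forall>\<beta>. \<beta> \<subseteq> \<alpha> \<longrightarrow> \<beta> \<in> X))"

definition face_dim :: "'a set \<Rightarrow> int" where
  "face_dim \<alpha> = int (card \<alpha>) - 1"

definition vertices :: "'a set set \<Rightarrow> 'a set" where
  "vertices X = {v. {v} \<in> X}"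

definition induced :: "'a set set \<Rightarrow> 'a set \<Rightarrow> 'a set set" where
  "induced X A = {\<alpha> \<in> X. \<alpha> \<subseteq> A}"

definition skel :: "int \<Rightarrow> 'a set set \<Rightarrow> 'a set set" where
  "skel j X = {\<alpha> \<in> X. face_dim \<alpha> \<le> j}"

definition link :: "'a set \<Rightarrow> 'a set set \<Rightarrow> 'a set set" where
  "link \<alpha> X = {\<gamma> \<in> X. \<gamma> \<inter> \<alpha> = {} \<and> \<gamma> \<union> \<alpha> \<in> X}"

definition pure :: "int \<Rightarrow> 'a set set \<Rightarrow> bool" where
  "pure n X \<longleftrightarrow> (\<forall>\<alpha>\<in>X. (\<forall>\<beta>\<in>X. \<alpha> \<subseteq> \<beta> \<longrightarrow> \<beta> = \<alpha>) \<longrightarrow> face_dim \<alpha> = n)"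

definition connected_complex :: "'a set set \<Rightarrow> bool" where
  "connected_complex X \<longleftrightarrow>
     (\<forall>u \<in> vertices X. \<forall>v \<in> vertices X. (u, v) \<in> {(x, y). {x, y} \<in> X}\<^sup>*)"

definition neighbourly :: "nat \<Rightarrow> 'a set set \<Rightarrow> bool" where
  "neighbourly m X \<longleftrightarrow> (\<forall>A. A \<subseteq> vertices X \<and> card A = m \<longrightarrow> A \<in> X)"


section \<open>Simplicial homology with coefficients in a field\<close>

text \<open>
  Simplices are oriented by one total order of the vertices, chosen once for the whole vertex type,
  so that the chains of a subcomplex are literally chains of the ambient complex.
\<close>

definition vertex_order :: "'a rel" where
  "vertex_order = (SOME r. linear_order_on UNIV r)"

lemma linear_order_vertex_order: "linear_order_on UNIV (vertex_order :: 'a rel)"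
proof -
  obtain r :: "'a rel" where "well_order_on UNIV r"
    using well_order_on by blast
  then have "linear_order_on UNIV r"
    by (simp add: well_order_on_def)
  then show ?thesis
    unfolding vertex_order_def by (rule someI)
qed

text \<open>
  For \<open>v \<notin> \<tau>\<close>, the coefficient of \<open>\<tau>\<close> in the boundary of the increasingly ordered
  simplex \<open>insert v \<tau>\<close>.
\<close>

definition incidence :: "'a \<Rightarrow> 'a set \<Rightarrow> 'f::field" where
  "incidence v \<tau> = (-1) ^ card {w \<in> \<tau>. w \<noteq> v \<and> (w, v) \<in> vertex_order}"

text \<open>
  A chain is a coefficient function on simplices. The family \<open>K\<close> is either a complex \<open>X\<close>,
  in which case the empty face has degree \<open>-1\<close> and the resulting homology is reduced, or
  \<open>X - {{}}\<close>, which gives ordinary homology.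
\<close>

definition chains :: "'a set set \<Rightarrow> int \<Rightarrow> ('a set \<Rightarrow> 'f::field) set" where
  "chains K i = {c. \<forall>\<sigma>. c \<sigma> \<noteq> 0 \<longrightarrow> \<sigma> \<in> K \<and> face_dim \<sigma> = i}"

definition bd :: "'a set set \<Rightarrow> ('a set \<Rightarrow> 'f::field) \<Rightarrow> ('a set \<Rightarrow> 'f)" where
  "bd K c = (\<lambda>\<tau>. if \<tau> \<in> K then (\<Sum>v \<in> \<Union>K - \<tau>. incidence v \<tau> * c (insert v \<tau>)) else 0)"

definition cycles :: "'a set set \<Rightarrow> int \<Rightarrow> ('a set \<Rightarrow> 'f::field) set" where
  "cycles K i = {c \<in> chains K i. bd K c = (\<lambda>_. 0)}"

definition boundaries :: "'a set set \<Rightarrow> int \<Rightarrow> ('a set \<Rightarrow> 'f::field) set" where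
  "boundaries K i = bd K ` chains K (i + 1)"

definition hclass :: "'a set set \<Rightarrow> int \<Rightarrow> ('a set \<Rightarrow> 'f::field) \<Rightarrow> ('a set \<Rightarrow> 'f) set" where
  "hclass K i z = {w \<in> cycles K i. (\<lambda>\<sigma>. w \<sigma> - z \<sigma>) \<in> boundaries K i}"

definition homology :: "'a set set \<Rightarrow> int \<Rightarrow> ('a set \<Rightarrow> 'f::field) set set" where
  "homology K i = hclass K i ` cycles K i"

text \<open>
  The map into the homology of \<open>K\<close> induced by the inclusion of a smaller family: the class of
  \<open>z\<close> there is sent to the class of \<open>z\<close> in \<open>K\<close>.
\<close>

definition inclusion_map ::
    "'a set set \<Rightarrow> int \<Rightarrow> ('a set \<Rightarrow> 'f::field) set \<Rightarrow> ('a set \<Rightarrow> 'f) set" where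
  "inclusion_map K i C = (\<Union>z\<in>C. hclass K i z)"

definition homology_zero :: "'f::field itself \<Rightarrow> 'a set set \<Rightarrow> int \<Rightarrow> bool" where
  "homology_zero F K i \<longleftrightarrow>
     homology K i = {hclass K i (\<lambda>_. 0) :: ('a set \<Rightarrow> 'f) set}"

text \<open>
  The homology is isomorphic, as a vector space, to the field itself; the vector space structure
  of the homology is the quotient structure \<open>[z] + [w] = [z + w]\<close>, \<open>a [z] = [a z]\<close>.
\<close>

definition homology_iso_field :: "'f::field itself \<Rightarrow> 'a set set \<Rightarrow> int \<Rightarrow> bool" where
  "homology_iso_field F K i \<longleftrightarrow>
     (\<exists>\<phi> :: ('a set \<Rightarrow> 'f) set \<Rightarrow> 'f.
        bij_betw \<phi> (homology K i) UNIV \<and>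
        (\<forall>z \<in> cycles K i. \<forall>w \<in> cycles K i.
           \<phi> (hclass K i (\<lambda>\<sigma>. z \<sigma> + w \<sigma>)) = \<phi> (hclass K i z) + \<phi> (hclass K i w)) \<and>
        (\<forall>a. \<forall>z \<in> cycles K i.
           \<phi> (hclass K i (\<lambda>\<sigma>. a * z \<sigma>)) = a * \<phi> (hclass K i z)))"

definition acyclic_complex :: "'f::field itself \<Rightarrow> 'a set set \<Rightarrow> bool" where
  "acyclic_complex F X \<longleftrightarrow> (\<forall>i. homology_zero F X i)"

definition homology_sphere :: "'f::field itself \<Rightarrow> int \<Rightarrow> 'a set set \<Rightarrow> bool" where
  "homology_sphere F m X \<longleftrightarrow>
     homology_iso_field F X m \<and> (\<forall>i. i \<noteq> m \<longrightarrow> homology_zero F X i)"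


section \<open>Homology manifolds, stackedness and tightness\<close>

definition homology_manifold :: "'f::field itself \<Rightarrow> int \<Rightarrow> 'a set set \<Rightarrow> bool" where
  "homology_manifold F n X \<longleftrightarrow>
     simplicial_complex X \<and> pure n X \<and>
     (\<forall>\<alpha>\<in>X. \<alpha> \<noteq> {} \<longrightarrow> homology_sphere F (n - int (card \<alpha>)) (link \<alpha> X))"

definition mfd_boundary :: "'f::field itself \<Rightarrow> 'a set set \<Rightarrow> 'a set set" where
  "mfd_boundary F X = {\<alpha> \<in> X. \<alpha> = {} \<or> acyclic_complex F (link \<alpha> X)}"

text \<open>The empty face always lies in the boundary, so nonemptiness means having a nonempty face.\<close>

definition homology_manifold_with_boundary ::
    "'f::field itself \<Rightarrow> int \<Rightarrow> 'a set set \<Rightarrow> bool" where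
  "homology_manifold_with_boundary F n X \<longleftrightarrow>
     simplicial_complex X \<and> pure n X \<and>
     (\<forall>\<alpha>\<in>X. \<alpha> \<noteq> {} \<longrightarrow>
        homology_sphere F (n - int (card \<alpha>)) (link \<alpha> X) \<or> acyclic_complex F (link \<alpha> X)) \<and>
     mfd_boundary F X \<noteq> {{}} \<and>
     homology_manifold F (n - 1) (mfd_boundary F X)"

definition stacked :: "'f::field itself \<Rightarrow> nat \<Rightarrow> nat \<Rightarrow> 'a set set \<Rightarrow> bool" where
  "stacked F d k X \<longleftrightarrow>
     1 \<le> k \<and> k \<le> d \<and> homology_manifold_with_boundary F (int d + 1) X \<and>
     skel (int d - int k) X = skel (int d - int k) (mfd_boundary F X)"

text \<open>Tightness refers to ordinary, not reduced, homology, whence the removal of the empty face.\<close>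

definition tight :: "'f::field itself \<Rightarrow> 'a set set \<Rightarrow> bool" where
  "tight F X \<longleftrightarrow>
     connected_complex X \<and>
     (\<forall>A i. A \<subseteq> vertices X \<longrightarrow>
        inj_on (inclusion_map (X - {{}}) i)
          (homology (induced X A - {{}}) i :: ('a set \<Rightarrow> 'f) set set))"

end

theory Submission imports Defs begin

text \<open>
  Tightness says that a cycle of an induced subcomplex \<open>\<Delta>[A]\<close> which bounds in \<open>\<Delta>\<close> already bounds
  in \<open>\<Delta>[A]\<close> (\<open>inj_on_inclusion_map\<close>). Let the degree of the cycle be \<open>i \<ge> 0\<close>.

  If \<open>i < k\<close>, neighbourliness puts the full \<open>k\<close>-skeleton of the simplex on \<open>A\<close> into \<open>\<Delta>[A]\<close>. A reduced
  cycle of degree \<open>i\<close> is therefore the boundary of the cone over it from any vertex of \<open>A\<close>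
  (\<open>fill_by_cone\<close>).

  If \<open>i \<ge> k\<close>, start with any filling \<open>c\<close> in \<open>\<Delta>\<close> and remove the vertices outside \<open>A\<close> from it, one at a
  time. If \<open>v\<close> is such a vertex and \<open>B\<close> consists of the other vertices still in use, the part of \<open>c\<close>
  that contains \<open>v\<close> is a cone \<open>v * e\<close>. Since \<open>v\<close> does not occur in the given cycle, \<open>e\<close> is a cycle of
  degree \<open>i\<close> in the subcomplex induced on \<open>B\<close> in the link of \<open>v\<close>. If \<open>e\<close> bounds a chain \<open>f\<close> there,
  then \<open>v * e\<close> may be replaced by \<open>f\<close> without changing the boundary of \<open>c\<close> (\<open>fill_in_induced\<close>).

  That \<open>e\<close> does bound follows by induction on the dimension (\<open>fill_in_induced_if_links_acyclic\<close>).
  Stackedness says that every nonempty face of dimension at most \<open>d - k\<close> has acyclic link, and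
  links of vertices inherit this: the link of \<open>\<gamma>\<close> in the link of \<open>v\<close> is the link of the larger face
  \<open>insert v \<gamma>\<close>, while the dimension of the ambient complex drops by one as well. So either the
  link of \<open>v\<close> is acyclic, whence \<open>e\<close> bounds in the link and by induction in its induced subcomplex,
  or the dimension of the link is smaller than \<open>k\<close> and \<open>e = 0\<close>.
\<close>

section \<open>Chains and boundaries in subcomplexes\<close>

lemma face_subset: "simplicial_complex X \<Longrightarrow> \<alpha> \<in> X \<Longrightarrow> \<beta> \<subseteq> \<alpha> \<Longrightarrow> \<beta> \<in> X"
  by (simp add: simplicial_complex_def)

lemma finite_face: "simplicial_complex X \<Longrightarrow> \<alpha> \<in> X \<Longrightarrow> finite \<alpha>"
  by (simp add: simplicial_complex_def)

lemma empty_face: "simplicial_complex X \<Longrightarrow> {} \<in> X"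
  by (simp add: simplicial_complex_def)

lemma simplicial_complex_Pow: "finite V \<Longrightarrow> simplicial_complex (Pow V)"
  unfolding simplicial_complex_def by (auto intro: finite_subset)

lemma simplicial_complex_induced:
  "simplicial_complex X \<Longrightarrow> simplicial_complex (induced X A)"
  unfolding simplicial_complex_def induced_def by auto

lemma simplicial_complex_link:
  assumes "simplicial_complex X" and "\<alpha> \<in> X"
  shows "simplicial_complex (link \<alpha> X)"
proof -
  have "\<beta> \<in> link \<alpha> X" if "\<gamma> \<in> link \<alpha> X" "\<beta> \<subseteq> \<gamma>" for \<beta> \<gamma>
  proof -
    have "\<beta> \<union> \<alpha> \<subseteq> \<gamma> \<union> \<alpha>" using that by auto
    then show ?thesis
      using that assms unfolding simplicial_complex_def link_def by blast
  qed
  moreover have "finite (link \<alpha> X)" "\<And>\<gamma>. \<gamma> \<in> link \<alpha> X \<Longrightarrow> finite \<gamma>" "{} \<in> link \<alpha> X"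
    using assms by (simp_all add: link_def simplicial_complex_def)
  ultimately show ?thesis unfolding simplicial_complex_def by blast
qed

lemma vertices_eq_Union: "simplicial_complex X \<Longrightarrow> vertices X = \<Union>X"
  by (auto simp: vertices_def intro: face_subset)

lemma finite_Union_complex: "simplicial_complex X \<Longrightarrow> finite (\<Union>X)"
  by (rule finite_Union) (simp_all add: simplicial_complex_def)

lemma link_link_vertex:
  "\<gamma> \<in> link {v} X \<Longrightarrow> simplicial_complex X \<Longrightarrow> link \<gamma> (link {v} X) = link (insert v \<gamma>) X"
proof -
  assume g: "\<gamma> \<in> link {v} X" and X: "simplicial_complex X"
  have "\<delta> \<union> \<gamma> \<in> X" "insert v \<delta> \<in> X" if "\<delta> \<union> insert v \<gamma> \<in> X" for \<delta>
    by (rule face_subset[OF X that]; auto)+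
  then show ?thesis
    using g unfolding link_def by auto
qed

lemma chains_mono: "X \<subseteq> Y \<Longrightarrow> chains X i \<subseteq> chains Y i"
  unfolding chains_def by auto

lemma zero_in_boundaries: "(\<lambda>_. 0) \<in> boundaries K i"
proof -
  have "(\<lambda>_. 0) = bd K (\<lambda>_. 0)" and "(\<lambda>_. 0) \<in> chains K (i + 1)"
    by (simp_all add: bd_def chains_def fun_eq_iff)
  then show ?thesis unfolding boundaries_def by (rule image_eqI)
qed

lemma bd_add: "bd K (\<lambda>\<sigma>. b \<sigma> + c \<sigma>) = (\<lambda>\<sigma>. bd K b \<sigma> + bd K c \<sigma>)"
  unfolding bd_def by (auto simp: fun_eq_iff distrib_left sum.distrib)

lemma bd_diff: "bd K (\<lambda>\<sigma>. b \<sigma> - c \<sigma>) = (\<lambda>\<sigma>. bd K b \<sigma> - bd K c \<sigma>)"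
  unfolding bd_def by (auto simp: fun_eq_iff right_diff_distrib sum_subtractf)

lemma chains_add: "b \<in> chains K i \<Longrightarrow> c \<in> chains K i \<Longrightarrow> (\<lambda>\<sigma>. b \<sigma> + c \<sigma>) \<in> chains K i"
  unfolding chains_def by clarsimp (metis add_0)

lemma chains_diff: "b \<in> chains K i \<Longrightarrow> c \<in> chains K i \<Longrightarrow> (\<lambda>\<sigma>. b \<sigma> - c \<sigma>) \<in> chains K i"
  unfolding chains_def by clarsimp (metis diff_0_right)

lemma boundaries_add:
  "b \<in> boundaries K i \<Longrightarrow> c \<in> boundaries K i \<Longrightarrow> (\<lambda>\<sigma>. b \<sigma> + c \<sigma>) \<in> boundaries K i"
proof -
  assume "b \<in> boundaries K i" and "c \<in> boundaries K i"
  then obtain b' c' where "b' \<in> chains K (i + 1)" "b = bd K b'" "c' \<in> chains K (i + 1)" "c = bd K c'"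
    by (auto simp: boundaries_def)
  then have "(\<lambda>\<sigma>. b \<sigma> + c \<sigma>) = bd K (\<lambda>\<sigma>. b' \<sigma> + c' \<sigma>)"
    and "(\<lambda>\<sigma>. b' \<sigma> + c' \<sigma>) \<in> chains K (i + 1)"
    by (simp_all add: bd_add chains_add)
  then show ?thesis unfolding boundaries_def by (rule image_eqI)
qed

lemma boundaries_diff:
  "b \<in> boundaries K i \<Longrightarrow> c \<in> boundaries K i \<Longrightarrow> (\<lambda>\<sigma>. b \<sigma> - c \<sigma>) \<in> boundaries K i"
proof -
  assume "b \<in> boundaries K i" and "c \<in> boundaries K i"
  then obtain b' c' where "b' \<in> chains K (i + 1)" "b = bd K b'" "c' \<in> chains K (i + 1)" "c = bd K c'"
    by (auto simp: boundaries_def)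
  then have "(\<lambda>\<sigma>. b \<sigma> - c \<sigma>) = bd K (\<lambda>\<sigma>. b' \<sigma> - c' \<sigma>)"
    and "(\<lambda>\<sigma>. b' \<sigma> - c' \<sigma>) \<in> chains K (i + 1)"
    by (simp_all add: bd_diff chains_diff)
  then show ?thesis unfolding boundaries_def by (rule image_eqI)
qed

text \<open>
  By this, the boundaries taken in a complex, its induced subcomplexes and its links all
  agree with the boundary in the full simplex \<open>Pow V\<close>, where cone formulas have no side conditions
  on membership.
\<close>

lemma bd_subcomplex:
  assumes "simplicial_complex X" and "simplicial_complex Y" and "X \<subseteq> Y" and "c \<in> chains X i"
  shows "bd Y c = bd X c"
proof
  fix \<tau>
  have out: "c (insert v \<tau>) = 0" if "insert v \<tau> \<notin> X" for v
    using assms(4) that unfolding chains_def by auto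
  show "bd Y c \<tau> = bd X c \<tau>"
  proof (cases "\<tau> \<in> X")
    case True
    have "(\<Sum>v\<in>\<Union>Y - \<tau>. incidence v \<tau> * c (insert v \<tau>)) =
        (\<Sum>v\<in>\<Union>X - \<tau>. incidence v \<tau> * c (insert v \<tau>))"
      by (rule sum.mono_neutral_right)
        (use assms out finite_Union_complex in \<open>auto\<close>)
    then show ?thesis using True assms(3) by (auto simp: bd_def)
  next
    case False
    then have "insert v \<tau> \<notin> X" for v
      using face_subset[OF assms(1) _ subset_insertI] by blast
    then show ?thesis using False out by (simp add: bd_def)
  qed
qed

lemma chain_eq_0: "c \<in> chains K i \<Longrightarrow> (\<And>\<sigma>. \<sigma> \<in> K \<Longrightarrow> face_dim \<sigma> \<noteq> i) \<Longrightarrow> c = (\<lambda>_. 0)"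
  unfolding chains_def by (rule ext) blast

lemma homology_zeroD:
  assumes "homology_zero TYPE('f::field) K i" and "z \<in> cycles K i"
  shows "(z :: 'a set \<Rightarrow> 'f) \<in> boundaries K i"
proof -
  have "hclass K i z = hclass K i (\<lambda>_. 0)"
    using assms unfolding homology_zero_def homology_def by auto
  moreover have "z \<in> hclass K i z"
    using assms(2) zero_in_boundaries by (simp add: hclass_def)
  ultimately show ?thesis by (simp add: hclass_def)
qed


section \<open>Cones\<close>

lemma incidence_sq: "incidence v \<tau> * incidence v \<tau> = (1 :: 'f::field)"
  unfolding incidence_def by (simp flip: power_add power_mult_distrib)

lemma incidence_insert:
  assumes "finite \<tau>" and "v \<notin> \<tau>" and "v \<noteq> w"
  shows "incidence w (insert v \<tau>) =
    (if (v, w) \<in> vertex_order then - incidence w \<tau> else (incidence w \<tau> :: 'f::field))"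
proof -
  have "{u \<in> insert v \<tau>. u \<noteq> w \<and> (u, w) \<in> vertex_order} =
     (if (v, w) \<in> vertex_order then insert v {u \<in> \<tau>. u \<noteq> w \<and> (u, w) \<in> vertex_order}
      else {u \<in> \<tau>. u \<noteq> w \<and> (u, w) \<in> vertex_order})"
    using assms by auto
  then show ?thesis using assms by (simp add: incidence_def)
qed

text \<open>
  Exactly one of two distinct vertices precedes the other, so exactly one of the two
  incidences changes sign when the other vertex is inserted.
\<close>

lemma incidence_anticommute:
  assumes "finite \<tau>" and "v \<notin> \<tau>" and "w \<notin> \<tau>" and "v \<noteq> w"
  shows "incidence w (insert v \<tau>) * incidence v \<tau> =
    - (incidence v (insert w \<tau>) * incidence w \<tau> :: 'f::field)"
    and "incidence w (insert v \<tau>) * incidence v (insert w \<tau>) =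
    - (incidence v \<tau> * incidence w \<tau> :: 'f)"
proof -
  have "(v, w) \<in> vertex_order \<longleftrightarrow> (w, v) \<notin> vertex_order"
    using linear_order_vertex_order[where 'a='a] assms(4)
    unfolding linear_order_on_def partial_order_on_def total_on_def antisym_def by auto
  then show "incidence w (insert v \<tau>) * incidence v \<tau> =
      - (incidence v (insert w \<tau>) * incidence w \<tau> :: 'f)"
    and "incidence w (insert v \<tau>) * incidence v (insert w \<tau>) =
      - (incidence v \<tau> * incidence w \<tau> :: 'f)"
    using assms by (auto simp: incidence_insert)
qed

text \<open>
  Faces of \<open>f\<close> that already contain the apex are dropped. With this convention \<open>bd_cone\<close> holds for
  every chain, not only for chains in the link of the apex.
\<close>

definition cone :: "'a \<Rightarrow> ('a set \<Rightarrow> 'f::field) \<Rightarrow> 'a set \<Rightarrow> 'f" where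
  "cone a f \<sigma> = (if a \<in> \<sigma> then incidence a (\<sigma> - {a}) * f (\<sigma> - {a}) else 0)"

text \<open>
  On faces without the apex only the insertion of the apex contributes. On a face
  \<open>\<tau> = insert a \<rho>\<close> the boundary of the cone and the cone over the boundary cancel term by term,
  because \<open>a\<close> and the other inserted vertex anticommute; the one term left over, which comes from
  inserting \<open>a\<close> into \<open>\<rho>\<close>, is \<open>f \<tau>\<close>.
\<close>

lemma bd_cone:
  assumes "finite V" and "a \<in> V" and "f \<in> chains (Pow V) i"
  shows "bd (Pow V) (cone a f) = (\<lambda>\<tau>. f \<tau> - cone a (bd (Pow V) f) \<tau>)"
proof
  fix \<tau>
  show "bd (Pow V) (cone a f) \<tau> = f \<tau> - cone a (bd (Pow V) f) \<tau>"
  proof (cases "\<tau> \<subseteq> V")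
    case False
    then have "f \<tau> = 0" "\<not> \<tau> - {a} \<subseteq> V" using assms by (auto simp: chains_def)
    then show ?thesis using False by (auto simp: bd_def cone_def)
  next
    case True
    then have fin: "finite \<tau>" using assms(1) finite_subset by blast
    show ?thesis
    proof (cases "a \<in> \<tau>")
      case False
      have "(\<Sum>v\<in>V - \<tau>. incidence v \<tau> * cone a f (insert v \<tau>)) =
          (\<Sum>v\<in>{a}. incidence v \<tau> * cone a f (insert v \<tau>))"
        by (rule sum.mono_neutral_right) (use assms False in \<open>auto simp: cone_def\<close>)
      also have "\<dots> = (incidence a \<tau> * incidence a \<tau>) * f \<tau>"
        using False by (simp add: cone_def)
      finally show ?thesis using True False by (simp add: bd_def cone_def incidence_sq)
    next
      case a: True
      define \<rho> where "\<rho> = \<tau> - {a}"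
      have \<rho>: "\<tau> = insert a \<rho>" "a \<notin> \<rho>" "finite \<rho>" "\<rho> \<subseteq> V" using a fin True by (auto simp: \<rho>_def)
      have split: "V - \<rho> = insert a (V - \<tau>)" using \<rho> a assms(2) by auto
      have "bd (Pow V) (cone a f) \<tau> =
          (\<Sum>v\<in>V - \<tau>. - (incidence a \<rho> * (incidence v \<rho> * f (insert v \<rho>))))"
      proof -
        have "incidence v \<tau> * cone a f (insert v \<tau>) =
            - (incidence a \<rho> * (incidence v \<rho> * f (insert v \<rho>)))" if "v \<in> V - \<tau>" for v
        proof -
          have "insert v \<tau> - {a} = insert v \<rho>" using that \<rho> a by auto
          then have "incidence v \<tau> * cone a f (insert v \<tau>) =
              (incidence v (insert a \<rho>) * incidence a (insert v \<rho>)) * f (insert v \<rho>)"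
            using a by (simp add: cone_def \<rho>(1) mult.assoc)
          also have "incidence v (insert a \<rho>) * incidence a (insert v \<rho>) =
              - (incidence a \<rho> * incidence v \<rho> :: 'b)"
            by (rule incidence_anticommute(2)) (use that \<rho> in auto)
          finally show ?thesis by (simp add: mult.assoc)
        qed
        then show ?thesis using True by (auto simp: bd_def intro!: sum.cong)
      qed
      moreover have "cone a (bd (Pow V) f) \<tau> = incidence a \<rho> * bd (Pow V) f \<rho>"
        using a by (simp add: cone_def \<rho>_def)
      moreover have "bd (Pow V) f \<rho> =
          incidence a \<rho> * f \<tau> + (\<Sum>v\<in>V - \<tau>. incidence v \<rho> * f (insert v \<rho>))"
      proof -
        have "bd (Pow V) f \<rho> = (\<Sum>v\<in>insert a (V - \<tau>). incidence v \<rho> * f (insert v \<rho>))"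
          using \<rho>(4) split by (simp add: bd_def)
        then show ?thesis using assms(1) a \<rho>(1) by simp
      qed
      moreover have "incidence a \<rho> * (incidence a \<rho> * f \<tau>) = f \<tau>"
        using incidence_sq[of a \<rho>, where 'f='b] by (simp flip: mult.assoc)
      ultimately show ?thesis
        by (simp add: distrib_left sum_negf sum_distrib_left)
    qed
  qed
qed

text \<open>
  The double sum over ordered pairs of inserted vertices is antisymmetric. In characteristic two
  antisymmetry alone does not make it vanish, so the pairs are split by the vertex order and the two
  halves are cancelled against each other.
\<close>

lemma bd_bd:
  assumes "finite V"
  shows "bd (Pow V) (bd (Pow V) c) = (\<lambda>_. 0)"
proof
  fix \<tau>
  show "bd (Pow V) (bd (Pow V) c) \<tau> = 0"
  proof (cases "\<tau> \<subseteq> V")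
    case False
    then show ?thesis by (simp add: bd_def)
  next
    case True
    define W where "W = V - \<tau>"
    have fin: "finite \<tau>" "finite W" using assms True finite_subset by (auto simp: W_def)
    define g where "g = (\<lambda>(v, w). incidence v \<tau> * (incidence w (insert v \<tau>) * c (insert w (insert v \<tau>))))"
    have "bd (Pow V) (bd (Pow V) c) \<tau> = (\<Sum>v\<in>W. \<Sum>w\<in>W - {v}. g (v, w))"
    proof -
      have "V - insert v \<tau> = W - {v}" for v by (auto simp: W_def)
      then show ?thesis
        using True by (auto simp: bd_def g_def sum_distrib_left W_def intro!: sum.cong)
    qed
    also have "\<dots> = sum g (SIGMA v:W. W - {v})"
      using fin by (subst sum.Sigma) auto
    also have "\<dots> = sum g {(v, w). v \<in> W \<and> w \<in> W \<and> v \<noteq> w \<and> (v, w) \<in> vertex_order}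
        + sum g {(v, w). v \<in> W \<and> w \<in> W \<and> v \<noteq> w \<and> (w, v) \<in> vertex_order}" (is "_ = sum g ?P + sum g ?Q")
    proof -
      have "(SIGMA v:W. W - {v}) = ?P \<union> ?Q" "?P \<inter> ?Q = {}"
        using linear_order_vertex_order[where 'a='a]
        unfolding linear_order_on_def partial_order_on_def total_on_def antisym_def by auto
      moreover have "finite ?P" "finite ?Q"
        by (rule finite_subset[of _ "W \<times> W"]; use fin in auto)+
      ultimately show ?thesis by (simp add: sum.union_disjoint)
    qed
    also have "sum g ?Q = (\<Sum>p\<in>?P. g (prod.swap p))"
      by (rule sum.reindex_bij_witness[of _ prod.swap prod.swap]) auto
    also have "\<dots> = (\<Sum>p\<in>?P. - g p)"
    proof (rule sum.cong[OF refl])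
      fix p assume "p \<in> ?P"
      then obtain v w where p: "p = (v, w)" "v \<notin> \<tau>" "w \<notin> \<tau>" "v \<noteq> w" by (auto simp: W_def)
      have "g (w, v) = (incidence v (insert w \<tau>) * incidence w \<tau>) * c (insert w (insert v \<tau>))"
        by (simp add: g_def insert_commute mult.commute mult.left_commute)
      also have "incidence v (insert w \<tau>) * incidence w \<tau> =
          - (incidence w (insert v \<tau>) * incidence v \<tau> :: 'b)"
        using incidence_anticommute(1)[OF fin(1) p(3,2) p(4)[symmetric]] .
      finally show "g (prod.swap p) = - g p"
        by (simp add: p g_def mult.commute mult.left_commute)
    qed
    finally show ?thesis by (simp add: sum_negf)
  qed
qed

section \<open>Removing vertices from a filling\<close>

text \<open>
  The inner claim removes the vertices of \<open>M\<close> from a filling. For a vertex \<open>v\<close> to be removed, \<open>b\<close> is the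
  part of the filling without \<open>v\<close>, and the rest is the cone from \<open>v\<close> over \<open>e\<close>. The cone formula turns the
  boundary of the filling into \<open>bd b + e - cone v (bd e)\<close>, where the last term is the part
  on faces containing \<open>v\<close>.
\<close>

lemma fill_in_induced:
  fixes c :: "'a set \<Rightarrow> 'f::field"
  assumes X: "simplicial_complex X"
    and links: "\<And>v B. v \<in> vertices X \<Longrightarrow>
      (cycles (induced (link {v} X) B) i :: ('a set \<Rightarrow> 'f) set)
        \<subseteq> boundaries (induced (link {v} X) B) i"
    and c: "c \<in> chains X (i + 1)" and z: "bd X c \<in> chains (induced X A) i"
  shows "bd X c \<in> boundaries (induced X A) i"
proof -
  define V where "V = \<Union>X"
  have V: "finite V" "X \<subseteq> Pow V" using X finite_Union_complex by (auto simp: V_def)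
  let ?D = "bd (Pow V) :: ('a set \<Rightarrow> 'f) \<Rightarrow> _"
  have bdD: "bd Y b = ?D b" if "simplicial_complex Y" "Y \<subseteq> X" "b \<in> chains Y j" for Y b j
    using bd_subcomplex[OF that(1) simplicial_complex_Pow[OF V(1)] _ that(3)] that(2) V(2) by auto
  have fill: "\<exists>b \<in> chains (induced X A) (i + 1). ?D b = bd X c"
    if "finite M" "c' \<in> chains (induced X (A \<union> M)) (i + 1)" "?D c' = bd X c" for M c'
    using that
  proof (induction M arbitrary: c' rule: finite_induct)
    case empty
    then show ?case by auto
  next
    case (insert v M)
    show ?case
    proof (cases "v \<in> A \<or> v \<notin> V")
      case True
      then have "induced X (A \<union> insert v M) \<subseteq> induced X (A \<union> M)"
        using V(2) by (auto simp: induced_def)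
      then show ?thesis using insert chains_mono by blast
    next
      case False
      then have vA: "v \<notin> A" and vV: "v \<in> V" by auto
      then have vX: "v \<in> vertices X" using X by (simp add: V_def vertices_eq_Union)
      define B where "B = A \<union> M"
      have vB: "v \<notin> B" using vA insert.hyps by (simp add: B_def)
      have lkX: "induced (link {v} X) B \<subseteq> X" and lkB: "induced (link {v} X) B \<subseteq> induced X B"
        by (auto simp: induced_def link_def)
      have lk: "simplicial_complex (induced (link {v} X) B)"
        using X vX by (auto simp: vertices_def intro!: simplicial_complex_induced simplicial_complex_link)
      have c': "c' \<sigma> \<noteq> 0 \<Longrightarrow> \<sigma> \<in> X \<and> \<sigma> \<subseteq> insert v B \<and> face_dim \<sigma> = i + 1" for \<sigma>
        using insert.prems(1) unfolding chains_def induced_def B_def by force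
      define b where "b = (\<lambda>\<sigma>. if v \<in> \<sigma> then 0 else c' \<sigma>)"
      define e where "e = (\<lambda>\<sigma>. if v \<in> \<sigma> then 0 else incidence v \<sigma> * c' (insert v \<sigma>))"
      have b: "b \<in> chains (induced X B) (i + 1)"
        using c' by (auto simp: b_def chains_def induced_def)
      have e: "e \<in> chains (induced (link {v} X) B) i"
        unfolding chains_def
      proof clarsimp
        fix \<sigma> assume "e \<sigma> \<noteq> 0"
        then have v: "v \<notin> \<sigma>" and s: "insert v \<sigma> \<in> X" "\<sigma> \<subseteq> insert v B" "face_dim (insert v \<sigma>) = i + 1"
          using c'[of "insert v \<sigma>"] by (auto simp: e_def split: if_splits)
        have "finite \<sigma>" "\<sigma> \<in> X"
          using finite_face[OF X s(1)] face_subset[OF X s(1) subset_insertI] by auto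
        then show "\<sigma> \<in> induced (link {v} X) B \<and> face_dim \<sigma> = i"
          using v s by (auto simp: induced_def link_def face_dim_def)
      qed
      have eP: "e \<in> chains (Pow V) i"
        using e chains_mono lkX V(2) by blast
      have "c' = (\<lambda>\<sigma>. b \<sigma> + cone v e \<sigma>)"
      proof
        fix \<sigma>
        have "incidence v (\<sigma> - {v}) * (incidence v (\<sigma> - {v}) * c' \<sigma>) = c' \<sigma>"
          using incidence_sq[of v "\<sigma> - {v}", where 'f='f] by (simp flip: mult.assoc)
        then show "c' \<sigma> = b \<sigma> + cone v e \<sigma>"
          by (auto simp: b_def cone_def e_def insert_absorb)
      qed
      then have split: "bd X c \<tau> = ?D b \<tau> + e \<tau> - cone v (?D e) \<tau>" for \<tau>
        using insert.prems(2) bd_cone[OF V(1) vV eP] bd_add[of "Pow V" b "cone v e"]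
        by (metis add_diff_eq)
      \<comment> \<open>the given cycle lies in \<open>A\<close>, so it vanishes on all faces that contain \<open>v\<close>\<close>
      have De: "?D e = (\<lambda>_. 0)"
      proof
        fix \<rho>
        show "?D e \<rho> = 0"
        proof (cases "v \<in> \<rho>")
          case True
          then show ?thesis by (simp add: bd_def e_def)
        next
          case False
          have "bd X c (insert v \<rho>) = 0"
            using z vA by (auto simp: chains_def induced_def)
          moreover have "?D b (insert v \<rho>) = 0" "e (insert v \<rho>) = 0"
            by (auto simp: bd_def b_def e_def)
          ultimately have "incidence v \<rho> * ?D e \<rho> = 0"
            using split[of "insert v \<rho>"] False by (simp add: cone_def)
          then show ?thesis by (simp add: incidence_def)
        qed
      qed
      then have "e \<in> cycles (induced (link {v} X) B) i"
        using e bdD[OF lk lkX e] by (simp add: cycles_def)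
      then obtain f where f: "f \<in> chains (induced (link {v} X) B) (i + 1)" "?D f = e"
        using links[OF vX, of B] bdD[OF lk lkX] unfolding boundaries_def by force
      have "(\<lambda>\<sigma>. b \<sigma> + f \<sigma>) \<in> chains (induced X B) (i + 1)"
        using b f(1) chains_mono[OF lkB] by (blast intro: chains_add)
      moreover have "?D (\<lambda>\<sigma>. b \<sigma> + f \<sigma>) = bd X c"
        using split by (auto simp: bd_add f(2) De cone_def)
      ultimately show ?thesis using insert.IH by (simp add: B_def)
    qed
  qed
  have "c \<in> chains (induced X (A \<union> V)) (i + 1)"
    using c V(2) by (auto simp: chains_def induced_def)
  then obtain b where "b \<in> chains (induced X A) (i + 1)" "?D b = bd X c"
    using fill[OF V(1)] bdD[OF X _ c] by force
  moreover have "induced X A \<subseteq> X" by (auto simp: induced_def)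
  ultimately show ?thesis
    using bdD[OF simplicial_complex_induced[OF X]] unfolding boundaries_def by force
qed

text \<open>
  Here \<open>n - 1\<close> bounds the dimension, and \<open>card \<alpha> + k < n\<close> singles out the faces of dimension less
  than \<open>n - 1 - k\<close>. Passing to the link of a
  vertex lowers \<open>card \<alpha>\<close> and \<open>n\<close> together and leaves the condition unchanged.
\<close>

lemma fill_in_induced_if_links_acyclic:
  fixes z :: "'a set \<Rightarrow> 'f::field"
  assumes "simplicial_complex X"
    and "\<And>\<alpha>. \<alpha> \<in> X \<Longrightarrow> card \<alpha> \<le> n"
    and "\<And>\<alpha>. \<alpha> \<in> X \<Longrightarrow> \<alpha> \<noteq> {} \<Longrightarrow> card \<alpha> + k < n \<Longrightarrow> acyclic_complex TYPE('f) (link \<alpha> X)"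
    and "int k \<le> i" and "z \<in> chains (induced X A) i" and "z \<in> boundaries X i"
  shows "z \<in> boundaries (induced X A) i"
  using assms
proof (induction n arbitrary: X z A)
  case 0
  then have "face_dim \<sigma> \<noteq> i" if "\<sigma> \<in> induced X A" for \<sigma>
    using that by (auto simp: induced_def face_dim_def)
  then have "z = (\<lambda>_. 0)" by (rule chain_eq_0[OF "0.prems"(5)])
  then show ?case by (simp add: zero_in_boundaries)
next
  case (Suc n)
  note X = Suc.prems(1)
  obtain c where c: "c \<in> chains X (i + 1)" "z = bd X c"
    using Suc.prems(6) by (auto simp: boundaries_def)
  have "w \<in> boundaries (induced (link {v} X) B) i"
    if v: "v \<in> vertices X" and w: "w \<in> cycles (induced (link {v} X) B) i"
    for v B and w :: "'a set \<Rightarrow> 'f"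
  proof -
    let ?L = "link {v} X"
    have vX: "{v} \<in> X" using v by (simp add: vertices_def)
    have L: "simplicial_complex ?L" by (rule simplicial_complex_link[OF X vX])
    have ins: "insert v \<gamma> \<in> X \<and> card (insert v \<gamma>) = Suc (card \<gamma>)" if "\<gamma> \<in> ?L" for \<gamma>
    proof -
      have "finite \<gamma>" by (rule finite_face[OF L that])
      then show ?thesis using that by (auto simp: link_def)
    qed
    have card: "card \<gamma> \<le> n" if "\<gamma> \<in> ?L" for \<gamma>
      using ins[OF that] Suc.prems(2)[of "insert v \<gamma>"] by simp
    have wc: "w \<in> chains (induced ?L B) i" using w by (simp add: cycles_def)
    show ?thesis
    proof (cases "k < n")
      \<comment> \<open>the vertex \<open>v\<close> itself satisfies the cardinality condition, as \<open>1 + k < Suc n\<close>\<close>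
      case True
      have "acyclic_complex TYPE('f) ?L"
        using Suc.prems(3)[OF vX] True by simp
      moreover have "w \<in> cycles ?L i"
        using w wc bd_subcomplex[OF simplicial_complex_induced[OF L] L _ wc] chains_mono[of "induced ?L B" ?L]
        by (auto simp: cycles_def induced_def)
      ultimately have "w \<in> boundaries ?L i"
        by (auto simp: acyclic_complex_def intro: homology_zeroD)
      moreover have "acyclic_complex TYPE('f) (link \<gamma> ?L)" if "\<gamma> \<in> ?L" "card \<gamma> + k < n" for \<gamma>
        using Suc.prems(3)[of "insert v \<gamma>"] ins[OF that(1)] that link_link_vertex[OF that(1) X] by simp
      ultimately show ?thesis
        using Suc.IH[OF L card _ Suc.prems(4) wc] by blast
    next
      \<comment> \<open>the link has dimension at most \<open>n - 1 < k \<le> i\<close>, hence no chains of degree \<open>i\<close>\<close>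
      case False
      have "face_dim \<sigma> \<noteq> i" if "\<sigma> \<in> induced ?L B" for \<sigma>
        using card[of \<sigma>] that False Suc.prems(4) by (auto simp: induced_def face_dim_def)
      then have "w = (\<lambda>_. 0)" by (rule chain_eq_0[OF wc])
      then show ?thesis by (simp add: zero_in_boundaries)
    qed
  qed
  then show ?case
    using fill_in_induced[OF X _ c(1), of A] Suc.prems(5) c(2) by blast
qed

lemma fill_by_cone:
  fixes z :: "'a set \<Rightarrow> 'f::field"
  assumes Y: "simplicial_complex Y"
    and full: "\<And>\<sigma>. \<sigma> \<subseteq> \<Union>Y \<Longrightarrow> face_dim \<sigma> \<le> i + 1 \<Longrightarrow> \<sigma> \<in> Y"
    and i: "0 \<le> i" and z: "z \<in> cycles Y i"
  shows "z \<in> boundaries Y i"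
proof (cases "\<Union>Y = {}")
  case True
  then have "face_dim \<sigma> \<noteq> i" if "\<sigma> \<in> Y" for \<sigma>
    using that i by (auto simp: face_dim_def)
  then have "z = (\<lambda>_. 0)" using z by (auto simp: cycles_def intro: chain_eq_0)
  then show ?thesis by (simp add: zero_in_boundaries)
next
  case False
  then obtain a where a: "a \<in> \<Union>Y" by blast
  let ?V = "\<Union>Y"
  have V: "finite ?V" "Y \<subseteq> Pow ?V" using Y finite_Union_complex by auto
  note bdD = bd_subcomplex[OF Y simplicial_complex_Pow[OF V(1)] V(2)]
  have zY: "z \<in> chains Y i" and zP: "z \<in> chains (Pow ?V) i"
    using z chains_mono[OF V(2)] by (auto simp: cycles_def)
  have cY: "cone a z \<in> chains Y (i + 1)"
    unfolding chains_def
  proof clarsimp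
    fix \<sigma> assume "cone a z \<sigma> \<noteq> 0"
    then have s: "a \<in> \<sigma>" "\<sigma> - {a} \<in> Y" "face_dim (\<sigma> - {a}) = i"
      using zY by (auto simp: cone_def chains_def split: if_splits)
    then have "finite (\<sigma> - {a})" using finite_face[OF Y] by blast
    then have "finite \<sigma>" by simp
    then have "face_dim \<sigma> = i + 1"
      using s card_Suc_Diff1[of \<sigma> a] by (simp add: face_dim_def)
    moreover have "\<sigma> \<subseteq> ?V" using s a by blast
    ultimately show "\<sigma> \<in> Y \<and> face_dim \<sigma> = i + 1" using full by simp
  qed
  have "bd (Pow ?V) z = (\<lambda>_. 0)" using z bdD[OF zY] by (simp add: cycles_def)
  then have "bd Y (cone a z) = z"
    using bd_cone[OF V(1) a zP] bdD[OF cY] by (simp add: cone_def fun_eq_iff)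
  then show ?thesis using cY unfolding boundaries_def by force
qed


section \<open>Tightness\<close>

text \<open>
  The arguments above are about reduced homology, while tightness is about ordinary homology. The
  two notions of boundary differ only in the value at the empty face, which only chains of
  degree zero can see; in particular the boundaries in nonnegative degrees are the same.
\<close>

lemma bd_unreduced: "bd (X - {{}}) c = (\<lambda>\<tau>. if \<tau> = {} then 0 else bd X c \<tau>)"
proof -
  have "\<Union>(X - {{}}) = \<Union>X" by auto
  then show ?thesis by (auto simp: bd_def fun_eq_iff)
qed

lemma bd_unreduced_eq:
  assumes "c \<in> chains (X - {{}}) i" and "i \<noteq> 0"
  shows "bd (X - {{}}) c = bd X c"
proof -
  have "c {v} = 0" for v
    using assms by (auto simp: chains_def face_dim_def)
  then have "bd X c {} = 0" by (simp add: bd_def)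
  then show ?thesis by (auto simp: bd_unreduced fun_eq_iff)
qed

lemma chains_unreduced: "0 \<le> i \<Longrightarrow> chains (X - {{}}) i = chains X i"
  by (auto simp: chains_def face_dim_def)

lemma inj_on_inclusion_map:
  assumes X: "simplicial_complex X"
    and fill: "\<And>z :: 'a set \<Rightarrow> 'f::field. 0 \<le> i \<Longrightarrow> z \<in> chains (induced X A) i \<Longrightarrow>
      z \<in> boundaries X i \<Longrightarrow> z \<in> boundaries (induced X A) i"
  shows "inj_on (inclusion_map (X - {{}}) i)
    (homology (induced X A - {{}}) i :: ('a set \<Rightarrow> 'f) set set)"
proof (rule inj_onI)
  let ?K = "X - {{}}" and ?L = "induced X A - {{}}"
  fix C C' :: "('a set \<Rightarrow> 'f) set"
  assume "C \<in> homology ?L i" "C' \<in> homology ?L i"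
    and eq: "inclusion_map ?K i C = inclusion_map ?K i C'"
  then obtain z w where z: "z \<in> cycles ?L i" "C = hclass ?L i z"
    and w: "w \<in> cycles ?L i" "C' = hclass ?L i w"
    by (auto simp: homology_def)
  note Y = simplicial_complex_induced[OF X, of A]
  have YX: "induced X A \<subseteq> X" by (auto simp: induced_def)
  have zK: "z \<in> cycles ?K i"
  proof -
    have zL: "z \<in> chains ?L i" using z(1) by (simp add: cycles_def)
    then have "z \<in> chains ?K i" and zY: "z \<in> chains (induced X A) i"
      using YX by (auto simp: chains_def)
    moreover have "bd ?L z = (\<lambda>_. 0)" using z(1) by (simp add: cycles_def)
    moreover have "bd ?K z = bd ?L z"
      unfolding bd_unreduced[of X] bd_unreduced[of "induced X A"]
      using bd_subcomplex[OF Y X YX zY] by presburger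
    ultimately show ?thesis by (simp add: cycles_def)
  qed
  have bnd: "u \<in> boundaries ?L i" if u: "u \<in> chains ?L i" "u \<in> boundaries ?K i" for u :: "'a set \<Rightarrow> 'f"
  proof (cases "0 \<le> i")
    case False
    then have "face_dim \<sigma> \<noteq> i" if "\<sigma> \<in> ?L" for \<sigma>
      using that finite_face[OF Y, of \<sigma>] by (auto simp: face_dim_def card_gt_0_iff)
    then have "u = (\<lambda>_. 0)" by (rule chain_eq_0[OF u(1)])
    then show ?thesis by (simp add: zero_in_boundaries)
  next
    case True
    have same: "boundaries (Z - {{}}) i = (boundaries Z i :: ('a set \<Rightarrow> 'f) set)" for Z :: "'a set set"
      unfolding boundaries_def
    proof (rule image_cong)
      show "chains (Z - {{}}) (i + 1) = (chains Z (i + 1) :: ('a set \<Rightarrow> 'f) set)"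
        using True by (intro chains_unreduced) simp
      show "bd (Z - {{}}) c = bd Z c" if "c \<in> chains Z (i + 1)" for c :: "'a set \<Rightarrow> 'f"
        by (rule bd_unreduced_eq[of _ _ "i + 1"]) (use that True chains_unreduced[of "i+1" Z] in auto)
    qed
    show ?thesis using fill[OF True] u chains_unreduced[OF True] same by blast
  qed
  have "z \<in> hclass ?K i z" using zK zero_in_boundaries by (simp add: hclass_def)
  moreover have "z \<in> C" using z zero_in_boundaries by (simp add: hclass_def)
  ultimately have "z \<in> inclusion_map ?K i C'"
    using eq unfolding inclusion_map_def by blast
  then obtain w' where w': "w' \<in> hclass ?L i w" "z \<in> hclass ?K i w'"
    using w(2) by (auto simp: inclusion_map_def)
  have "(\<lambda>\<sigma>. z \<sigma> - w' \<sigma>) \<in> boundaries ?L i"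
    by (rule bnd) (use w' z(1) in \<open>auto simp: hclass_def cycles_def intro: chains_diff\<close>)
  moreover have "(\<lambda>\<sigma>. w' \<sigma> - w \<sigma>) \<in> boundaries ?L i" using w' by (simp add: hclass_def)
  ultimately have zw: "(\<lambda>\<sigma>. z \<sigma> - w \<sigma>) \<in> boundaries ?L i"
    using boundaries_add by fastforce
  have "(\<lambda>\<sigma>. u \<sigma> - z \<sigma>) \<in> boundaries ?L i \<longleftrightarrow> (\<lambda>\<sigma>. u \<sigma> - w \<sigma>) \<in> boundaries ?L i" for u
    using boundaries_add[OF _ zw, of "\<lambda>\<sigma>. u \<sigma> - z \<sigma>"] boundaries_diff[OF _ zw, of "\<lambda>\<sigma>. u \<sigma> - w \<sigma>"]
    by auto
  then show "C = C'" by (simp add: z w hclass_def)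
qed

lemma pure_face_le_facet:
  assumes "simplicial_complex X" and "pure n X" and "\<alpha> \<in> X"
  shows "\<exists>\<beta>\<in>X. \<alpha> \<subseteq> \<beta> \<and> face_dim \<beta> = n"
proof -
  have "finite X" using assms(1) by (simp add: simplicial_complex_def)
  then obtain \<beta> where \<beta>: "\<beta> \<in> X" "\<alpha> \<subseteq> \<beta>" "\<And>\<gamma>. \<gamma> \<in> X \<Longrightarrow> \<beta> \<subseteq> \<gamma> \<Longrightarrow> \<gamma> = \<beta>"
    using finite_has_maximal2[OF _ assms(3)] by metis
  then have "face_dim \<beta> = n" using assms(2) by (auto simp: pure_def)
  then show ?thesis using \<beta>(1,2) by blast
qed

text \<open>
  Neighbourliness speaks of sets of exactly \<open>m\<close> vertices; a smaller set is first enlarged, for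
  which there must be enough vertices.
\<close>

lemma neighbourly_small_face:
  assumes "simplicial_complex X" and "neighbourly m X"
    and "m \<le> card (vertices X)" and "\<sigma> \<subseteq> vertices X" and "card \<sigma> \<le> m"
  shows "\<sigma> \<in> X"
proof -
  have "finite (vertices X)"
    using assms(1) by (simp add: vertices_eq_Union finite_Union_complex)
  then obtain B where "\<sigma> \<subseteq> B" "B \<subseteq> vertices X" "card B = m"
    using exists_subset_between[of \<sigma> m "vertices X"] assms by blast
  then show ?thesis
    using assms(2) face_subset[OF assms(1)] unfolding neighbourly_def by blast
qed

theorem theorem13:
  fixes \<Delta> :: "'a set set" and k d :: nat
  assumes "k > 0"
    and "homology_manifold_with_boundary TYPE('f::field) (int d + 1) \<Delta>"
    and "stacked TYPE('f) d k \<Delta>"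
    and "neighbourly (k + 1) \<Delta>"
  shows "tight TYPE('f) \<Delta>"
proof -
  have X: "simplicial_complex \<Delta>" and pure: "pure (int d + 1) \<Delta>"
    using assms(2) by (auto simp: homology_manifold_with_boundary_def)
  have kd: "k \<le> d" and skel: "skel (int d - int k) \<Delta> = skel (int d - int k) (mfd_boundary TYPE('f) \<Delta>)"
    using assms(3) by (auto simp: stacked_def)
  have card: "card \<alpha> \<le> d + 2" if a: "\<alpha> \<in> \<Delta>" for \<alpha>
  proof -
    obtain \<beta> where b: "\<beta> \<in> \<Delta>" "\<alpha> \<subseteq> \<beta>" "face_dim \<beta> = int d + 1"
      using pure_face_le_facet[OF X pure a] by blast
    then have "card \<alpha> \<le> card \<beta>"
      using finite_face[OF X] by (auto intro: card_mono)
    then show ?thesis using b(3) by (simp add: face_dim_def)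
  qed
  have acyclic: "acyclic_complex TYPE('f) (link \<alpha> \<Delta>)"
    if "\<alpha> \<in> \<Delta>" "\<alpha> \<noteq> {}" "card \<alpha> + k < d + 2" for \<alpha>
  proof -
    have "\<alpha> \<in> skel (int d - int k) \<Delta>" using that by (auto simp: skel_def face_dim_def)
    then have "\<alpha> \<in> mfd_boundary TYPE('f) \<Delta>" using skel by (auto simp: skel_def)
    then show ?thesis using that by (simp add: mfd_boundary_def)
  qed
  have many: "k + 1 \<le> card (vertices \<Delta>)"
  proof -
    obtain \<beta> where b: "\<beta> \<in> \<Delta>" "face_dim \<beta> = int d + 1"
      using pure_face_le_facet[OF X pure empty_face[OF X]] by blast
    then have "card \<beta> \<le> card (vertices \<Delta>)"
      using X by (auto simp: vertices_eq_Union finite_Union_complex intro!: card_mono)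
    then show ?thesis using b kd by (simp add: face_dim_def)
  qed
  note small = neighbourly_small_face[OF X assms(4) many]
  have "connected_complex \<Delta>"
  proof -
    have "{u, v} \<in> \<Delta>" if "u \<in> vertices \<Delta>" "v \<in> vertices \<Delta>" for u v
      by (rule small) (use that assms(1) in \<open>auto simp: card_insert_if\<close>)
    then show ?thesis unfolding connected_complex_def by blast
  qed
  moreover have "z \<in> boundaries (induced \<Delta> A) i"
    if A: "A \<subseteq> vertices \<Delta>" and i: "0 \<le> i" and z: "z \<in> chains (induced \<Delta> A) i" "z \<in> boundaries \<Delta> i"
    for A i and z :: "'a set \<Rightarrow> 'f"
  proof (cases "int k \<le> i")
    case True
    then show ?thesis
      using fill_in_induced_if_links_acyclic[OF X card acyclic] z by blast
  next
    case False
    note Y = simplicial_complex_induced[OF X, of A]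
    let ?P = "Pow (\<Union>\<Delta>)"
    note V = finite_Union_complex[OF X]
    note P = simplicial_complex_Pow[OF V]
    obtain c where c: "c \<in> chains \<Delta> (i + 1)" "z = bd \<Delta> c" using z(2) by (auto simp: boundaries_def)
    have "\<Delta> \<subseteq> ?P" "induced \<Delta> A \<subseteq> ?P" by (auto simp: induced_def)
    then have "z = bd ?P c" "bd (induced \<Delta> A) z = bd ?P z"
      using c bd_subcomplex[OF X P _ c(1)] bd_subcomplex[OF Y P _ z(1)] by simp_all
    \<comment> \<open>in degree \<open>0\<close> being a reduced cycle is more than being a cycle; it holds since \<open>z\<close> bounds in \<open>\<Delta>\<close>\<close>
    then have cyc: "z \<in> cycles (induced \<Delta> A) i"
      using z(1) bd_bd[OF V, of c] by (simp add: cycles_def)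
    \<comment> \<open>the cone needs faces of dimension at most \<open>i + 1 \<le> k\<close>, which have at most \<open>k + 1\<close> vertices\<close>
    show ?thesis
    proof (rule fill_by_cone[OF Y _ i cyc])
      fix \<sigma> assume s: "\<sigma> \<subseteq> \<Union>(induced \<Delta> A)" "face_dim \<sigma> \<le> i + 1"
      then have "\<sigma> \<subseteq> A" by (auto simp: induced_def)
      moreover have "card \<sigma> \<le> k + 1" using s(2) False by (simp add: face_dim_def)
      ultimately show "\<sigma> \<in> induced \<Delta> A" using small A by (auto simp: induced_def)
    qed
  qed
  then have "inj_on (inclusion_map (\<Delta> - {{}}) i)
      (homology (induced \<Delta> A - {{}}) i :: ('a set \<Rightarrow> 'f) set set)" if "A \<subseteq> vertices \<Delta>" for A i
    by (rule inj_on_inclusion_map[OF X]) (rule that)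
  ultimately show ?thesis by (simp add: tight_def)
qed

end
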